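(* For finite sets $X_1,X_2$ and basis elements $(\mathcal{T}_1,Y_1)\in\mathbb{D}_{X_1}$ and $(\mathcal{T}_2,Y_2)\in\mathbb{D}_{X_2}$ set $$(\mathcal{T}_1,Y_1)\ast(\mathcal{T}_2,Y_2)=\begin{cases}(\mathcal{T}_1,\,Y_1\sqcup Y_2)&\text{if }X_2=X_1\setminus Y_1\text{ and }\mathcal{T}_2={\mathcal{T}_1}_{|X_2},\\ 0&\text{otherwise,}\end{cases}$$ extended bilinearly. Then the product $\ast:\mathbb{D}\otimes\mathbb{D}\to\mathbb{D}$ is associative: for all finite sets $X_1,X_2,X_3$ and all $a\in\mathbb{D}_{X_1}$, $b\in\mathbb{D}_{X_2}$, $c\in\mathbb{D}_{X_3}$, one has $(a\ast b)\ast c=a\ast(b\ast c)$.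
   Context: $\mathbf{k}$ is a field. A topology on a finite set $X$ is identified with its family $\mathcal{T}$ of open subsets; for $Y\subset X$, $\mathcal{T}_{|Y}=\{Z\cap Y:Z\in\mathcal{T}\}$. For a finite set $X$, $\mathbb{D}_X$ is the $\mathbf{k}$-vector space with basis the pairs $(\mathcal{T},Y)$ where $\mathcal{T}$ is a topology on $X$ and $Y\in\mathcal{T}$. The product of an element of $\mathbb{D}_{X_1}$ with an element of $\mathbb{D}_{X_2}$ lies in $\mathbb{D}_{X_1}$. *)

theory Defs
  imports "HOL-Analysis.Abstract_Topology" "HOL-Library.Poly_Mapping"
begin

text \<open>
  Finite sets are finite subsets of an ambient type \<^typ>\<open>'a\<close>. A topology on \<open>X\<close> is a
  \<^typ>\<open>'a topology\<close> with \<^const>\<open>topspace\<close> equal to \<open>X\<close>; two such objects are equal iff they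
  have the same open sets, so this is the identification of a topology with its family of
  open sets, and \<^const>\<open>subtopology\<close> is the trace family.
\<close>

definition D_basis :: "'a set \<Rightarrow> ('a topology \<times> 'a set) set" where
  "D_basis X = {(T, Y). topspace T = X \<and> openin T Y}"

text \<open>
  Elements of \<open>D_space X\<close> are formal linear combinations of \<^term>\<open>D_basis X\<close>, as finitely
  supported coefficient functions. For different \<open>X\<close> these spaces share only the zero vector.
\<close>

type_synonym ('a, 'k) dvec = "('a topology \<times> 'a set) \<Rightarrow>\<^sub>0 'k"

definition D_space :: "'a set \<Rightarrow> ('a, 'k::field) dvec set" where
  "D_space X = {a. Poly_Mapping.keys a \<subseteq> D_basis X}"

definition D_scale :: "'k::field \<Rightarrow> ('a, 'k) dvec \<Rightarrow> ('a, 'k) dvec" where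
  "D_scale c a = Poly_Mapping.map (\<lambda>x. c * x) a"

text \<open>The underlying sets \<open>X\<^sub>1\<close>, \<open>X\<^sub>2\<close> are recovered as the \<^const>\<open>topspace\<close>s.\<close>

definition basis_star ::
    "'a topology \<times> 'a set \<Rightarrow> 'a topology \<times> 'a set \<Rightarrow> ('a, 'k::field) dvec" where
  "basis_star = (\<lambda>(T1, Y1) (T2, Y2).
     if topspace T2 = topspace T1 - Y1 \<and> T2 = subtopology T1 (topspace T2)
     then Poly_Mapping.single (T1, Y1 \<union> Y2) 1
     else 0)"

definition star :: "('a, 'k::field) dvec \<Rightarrow> ('a, 'k) dvec \<Rightarrow> ('a, 'k) dvec"
    (infixl "\<star>" 70) where
  "a \<star> b = (\<Sum>p\<in>Poly_Mapping.keys a. \<Sum>q\<in>Poly_Mapping.keys b.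
     D_scale (Poly_Mapping.lookup a p * Poly_Mapping.lookup b q) (basis_star p q))"

lemma lookup_D_scale [simp]:
  "Poly_Mapping.lookup (D_scale c a) p = c * Poly_Mapping.lookup a p"
  by (simp add: D_scale_def Poly_Mapping.map.rep_eq when_def)

lemma vector_space_D_scale: "vector_space D_scale"
  by unfold_locales (auto intro!: poly_mapping_eqI simp: lookup_add algebra_simps)

interpretation D: vector_space D_scale
  by (rule vector_space_D_scale)

lemma keys_D_scale: "Poly_Mapping.keys (D_scale c a) \<subseteq> Poly_Mapping.keys a"
  by (auto simp: in_keys_iff)

lemma subspace_D_space: "D.subspace (D_space X :: ('a, 'k::field) dvec set)"
proof (rule D.subspaceI)
  show "0 \<in> D_space X" by (simp add: D_space_def)
next
  fix a b :: "('a, 'k) dvec" assume "a \<in> D_space X" "b \<in> D_space X"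
  then show "a + b \<in> D_space X"
    using Poly_Mapping.keys_add[of a b] unfolding D_space_def by blast
next
  fix c :: 'k and a :: "('a, 'k) dvec" assume "a \<in> D_space X"
  then show "D_scale c a \<in> D_space X"
    using keys_D_scale[of c a] unfolding D_space_def by blast
qed

lemma star_eq_sum_superset:
  assumes "finite A" "finite B" "Poly_Mapping.keys a \<subseteq> A" "Poly_Mapping.keys b \<subseteq> B"
  shows "a \<star> b = (\<Sum>p\<in>A. \<Sum>q\<in>B.
     D_scale (Poly_Mapping.lookup a p * Poly_Mapping.lookup b q) (basis_star p q))"
proof -
  have "a \<star> b = (\<Sum>p\<in>Poly_Mapping.keys a. \<Sum>q\<in>B.
     D_scale (Poly_Mapping.lookup a p * Poly_Mapping.lookup b q) (basis_star p q))"
    unfolding star_def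
    by (intro sum.cong refl sum.mono_neutral_left) (use assms in \<open>auto simp: in_keys_iff\<close>)
  also have "\<dots> = (\<Sum>p\<in>A. \<Sum>q\<in>B.
     D_scale (Poly_Mapping.lookup a p * Poly_Mapping.lookup b q) (basis_star p q))"
    by (intro sum.mono_neutral_left) (use assms in \<open>auto simp: in_keys_iff\<close>)
  finally show ?thesis .
qed

lemma star_single:
  "Poly_Mapping.single p 1 \<star> Poly_Mapping.single q 1 = (basis_star p q :: ('a, 'k::field) dvec)"
  by (simp add: star_def)

lemma star_add_left: "(a + a') \<star> b = a \<star> b + a' \<star> b"
proof -
  let ?A = "Poly_Mapping.keys a \<union> Poly_Mapping.keys a'"
  have "Poly_Mapping.keys (a + a') \<subseteq> ?A" by (rule Poly_Mapping.keys_add)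
  then show ?thesis
    by (simp add: star_eq_sum_superset[of ?A "Poly_Mapping.keys b"] lookup_add
        distrib_right D.scale_left_distrib sum.distrib)
qed

lemma star_add_right: "a \<star> (b + b') = a \<star> b + a \<star> b'"
proof -
  let ?B = "Poly_Mapping.keys b \<union> Poly_Mapping.keys b'"
  have "Poly_Mapping.keys (b + b') \<subseteq> ?B" by (rule Poly_Mapping.keys_add)
  then show ?thesis
    by (simp add: star_eq_sum_superset[of "Poly_Mapping.keys a" ?B] lookup_add
        distrib_left D.scale_left_distrib sum.distrib)
qed

lemma star_scale_left: "D_scale c a \<star> b = D_scale c (a \<star> b)"
  by (simp add: star_eq_sum_superset[OF _ _ keys_D_scale order_refl]
      star_def[of a b] D.scale_sum_right mult.assoc)

lemma star_scale_right: "a \<star> D_scale c b = D_scale c (a \<star> b)"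
  by (simp add: star_eq_sum_superset[OF _ _ order_refl keys_D_scale]
      star_def[of a b] D.scale_sum_right mult.left_commute)

lemma basis_star_closed:
  assumes "p \<in> D_basis X1" "q \<in> D_basis X2"
  shows "basis_star p q \<in> D_space X1"
proof -
  obtain T1 Y1 T2 Y2 where pq: "p = (T1, Y1)" "q = (T2, Y2)" by fastforce
  have "openin T1 (Y1 \<union> Y2)"
    if "topspace T2 = topspace T1 - Y1" "T2 = subtopology T1 (topspace T2)"
  proof -
    have "openin T1 Y1" "openin T2 Y2" using assms pq by (auto simp: D_basis_def)
    with that obtain Z where Z: "openin T1 Z" "Y2 = Z \<inter> (topspace T1 - Y1)"
      by (metis openin_subtopology)
    then have "Y1 \<union> Y2 = Y1 \<union> Z" using openin_subset by fastforce
    then show ?thesis using Z \<open>openin T1 Y1\<close> by (metis openin_Un)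
  qed
  then show ?thesis
    using assms by (auto simp: pq basis_star_def D_space_def D_basis_def)
qed

lemma star_closed:
  assumes "a \<in> D_space X1" "b \<in> D_space X2"
  shows "a \<star> b \<in> D_space X1"
  unfolding star_def
  by (intro D.subspace_sum D.subspace_scale subspace_D_space basis_star_closed)
    (use assms in \<open>auto simp: D_space_def\<close>)

end

theory Submission
  imports Defs
begin

text \<open>
  By trilinearity it suffices to compare the products of basis elements. If
  \<open>X\<^sub>2 = X\<^sub>1 - Y\<^sub>1\<close> and \<open>T\<^sub>2\<close> is the trace of \<open>T\<^sub>1\<close> on \<open>X\<^sub>2\<close>, then
  \<open>X\<^sub>2 - Y\<^sub>2 = X\<^sub>1 - (Y\<^sub>1 \<union> Y\<^sub>2)\<close> and the traces of \<open>T\<^sub>1\<close> and \<open>T\<^sub>2\<close> on this set agree, so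
  both bracketings impose the same conditions on \<open>(T\<^sub>3, Y\<^sub>3)\<close> and yield
  \<open>(T\<^sub>1, Y\<^sub>1 \<union> Y\<^sub>2 \<union> Y\<^sub>3)\<close>; otherwise both vanish.
\<close>

lemma star_zero_left [simp]: "0 \<star> b = 0"
  by (simp add: star_def)

lemma star_zero_right [simp]: "a \<star> 0 = 0"
  by (simp add: star_def)

text \<open>Splits off the coefficient, since \<open>star_single\<close> only covers coefficient
  1.\<close>

lemma single_eq_D_scale: "Poly_Mapping.single p v = D_scale v (Poly_Mapping.single p 1)"
  by (rule poly_mapping_eqI) (simp add: lookup_single when_def)

lemma poly_mapping_single_add_induct [case_names single add]:
  fixes f :: "'b \<Rightarrow>\<^sub>0 'c::monoid_add"
  assumes single: "\<And>k v. P (Poly_Mapping.single k v)"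
    and add: "\<And>f g. P f \<Longrightarrow> P g \<Longrightarrow> P (f + g)"
  shows "P f"
proof (induction f rule: update_induct)
  case const
  show ?case
    \<comment> \<open>The zero mapping is the monomial with coefficient 0.\<close>
    using single[of _ 0] by simp
next
  case (update f k v)
  \<comment> \<open>Here \<open>k\<close> is not a key of \<open>f\<close>, so overwriting its
    coefficient 0 amounts to adding a monomial.\<close>
  have "Poly_Mapping.update k v f = Poly_Mapping.single k v + f"
    using update.hyps
    by (intro poly_mapping_eqI)
      (auto simp: lookup_update lookup_add lookup_single in_keys_iff when_def)
  then show ?case
    by (simp add: add single update.IH)
qed

lemma basis_star_assoc:
  "basis_star p q \<star> Poly_Mapping.single r 1 =
    (Poly_Mapping.single p 1 \<star> basis_star q r :: ('a, 'k::field) dvec)"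
proof -
  obtain T1 Y1 T2 Y2 T3 Y3 where pqr: "p = (T1, Y1)" "q = (T2, Y2)" "r = (T3, Y3)"
    by (metis surj_pair)
  show ?thesis
  proof (cases "topspace T2 = topspace T1 - Y1 \<and> T2 = subtopology T1 (topspace T2)")
    case True
    define S where "S = topspace T1 - (Y1 \<union> Y2)"
    have S: "topspace T2 - Y2 = S"
      using True by (auto simp: S_def)
    have "subtopology T2 S = subtopology T1 (topspace T2 \<inter> S)"
      using True by (metis subtopology_subtopology)
    also have "topspace T2 \<inter> S = S"
      using S by blast
    finally have trace: "subtopology T2 S = subtopology T1 S" .
    have S_subset: "topspace T1 \<inter> S = S"
      by (auto simp: S_def)
    have pq: "basis_star p q = (Poly_Mapping.single (T1, Y1 \<union> Y2) 1 :: ('a, 'k) dvec)"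
      and pqr_right: "basis_star p (T2, Y2 \<union> Y3) =
        (Poly_Mapping.single (T1, Y1 \<union> (Y2 \<union> Y3)) 1 :: ('a, 'k) dvec)"
      using True by (auto simp: pqr basis_star_def)
    show ?thesis
    \<comment> \<open>By \<open>trace\<close>, this single condition decides whether
      \<open>basis_star q r\<close> and \<open>basis_star (T1, Y1 \<union> Y2) r\<close> are
      nonzero.\<close>
    proof (cases "topspace T3 = S \<and> T3 = subtopology T1 S")
      case True
      then have "basis_star q r = (Poly_Mapping.single (T2, Y2 \<union> Y3) 1 :: ('a, 'k) dvec)"
        and "basis_star (T1, Y1 \<union> Y2) r =
          (Poly_Mapping.single (T1, Y1 \<union> (Y2 \<union> Y3)) 1 :: ('a, 'k) dvec)"
        by (simp_all add: pqr basis_star_def S S_subset trace S_def[symmetric] Un_assoc)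
      then show ?thesis
        by (simp only: pq star_single pqr_right)
    next
      case False
      then have "basis_star q r = (0 :: ('a, 'k) dvec)"
        and "basis_star (T1, Y1 \<union> Y2) r = (0 :: ('a, 'k) dvec)"
        using trace by (auto simp: pqr basis_star_def S S_def[symmetric])
      then show ?thesis
        by (simp only: pq star_single star_zero_right)
    qed
  next
    case False
    \<comment> \<open>The failing condition involves \<open>T2\<close> but not \<open>Y2\<close>, so
      it persists for every \<open>Y\<close>. As \<open>basis_star q r\<close> is zero or again
      carries the topology \<open>T2\<close>, the right-hand side vanishes too.\<close>
    then have "basis_star p q = (0 :: ('a, 'k) dvec)"
      and "basis_star p (T2, Y) = (0 :: ('a, 'k) dvec)" for Y
      by (auto simp: pqr basis_star_def)
    moreover have "basis_star q r \<in>
        {0 :: ('a, 'k) dvec, Poly_Mapping.single (T2, Y2 \<union> Y3) 1}"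
      by (simp add: pqr basis_star_def)
    ultimately show ?thesis
      by (auto simp: star_single)
  qed
qed

text \<open>Both sides are additive in each argument, so three nested inductions leave monomials,
  whose scalars factor out.\<close>

lemma star_assoc: "(a \<star> b) \<star> c = a \<star> (b \<star> c)"
proof (induction a rule: poly_mapping_single_add_induct)
  case (single p u)
  show ?case
  proof (induction b rule: poly_mapping_single_add_induct)
    case (single q v)
    show ?case
    proof (induction c rule: poly_mapping_single_add_induct)
      case (single r w)
      show ?case
        by (simp only: single_eq_D_scale[of p u] single_eq_D_scale[of q v]
            single_eq_D_scale[of r w] star_scale_left star_scale_right star_single
            basis_star_assoc)
    qed (simp add: star_add_right)
  qed (simp add: star_add_left star_add_right)
qed (simp add: star_add_left)

theorem theorem4p1:
  fixes X1 X2 X3 :: "'a set"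
    and a b c :: "('a, 'k::field) dvec"
  assumes "finite X1" and "finite X2" and "finite X3"
    and "a \<in> D_space X1" and "b \<in> D_space X2" and "c \<in> D_space X3"
  shows "(a \<star> b) \<star> c = a \<star> (b \<star> c)"
  by (rule star_assoc)

end
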